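(* Every locale $L$ has a largest dense IED sublocale; that is, there is a dense sublocale $S$ of $L$ which is IED (as a locale) and which contains every dense IED sublocale of $L$.
   Context: A locale (= frame) is a complete lattice $L$ with $a\wedge\bigvee B=\bigvee\{a\wedge b\mid b\in B\}$ for all $a\in L$, $B\subseteq L$. It is a complete Heyting algebra with Heyting operation $\to$; the pseudocomplement of $a$ is $a^*=a\to 0$, and $a^{**}=(a^* )^*$. A sublocale of $L$ is a subset $S\subseteq L$ closed under arbitrary meets of $L$ (including the empty one) and such that $a\to s\in S$ for all $a\in L$, $s\in S$; with the induced order $S$ is itself a locale. Sublocales are ordered by inclusion. A sublocale $S$ is dense if $0\in S$. A locale $M$ is IED (infinitely extremally disconnected) if $(\bigvee a_i)^{**}\le\bigvee a_i^{**}$ for every family $\{a_i\}_{i\in I}\subseteq M$ (arbitrary index set), with joins and pseudocomplements computed in $M$. *)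

theory Defs
  imports Main
begin

text \<open>
  Locales are rendered as the type class of frames. The library class
  \<^class>\<open>complete_distrib_lattice\<close> asks for complete distributivity, which is strictly
  stronger, so the frame law is imposed on \<^class>\<open>complete_lattice\<close> directly.
\<close>

class frame = complete_lattice +
  assumes inf_Sup_frame: "inf a (Sup B) = Sup {inf a b | b. b \<in> B}"

definition heyting :: "'a::frame \<Rightarrow> 'a \<Rightarrow> 'a" where
  "heyting a b = Sup {c. inf c a \<le> b}"

lemma heyting_adjoint: "c \<le> heyting a b \<longleftrightarrow> inf c a \<le> (b::'a::frame)"
proof
  assume "c \<le> heyting a b"
  then have "inf c a \<le> inf a (heyting a b)"
    by (simp add: inf.commute le_infI2)
  also have "\<dots> = Sup {inf a x | x. x \<in> {c. inf c a \<le> b}}"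
    unfolding heyting_def by (rule inf_Sup_frame)
  also have "\<dots> \<le> b"
    by (rule Sup_least) (auto simp: inf.commute)
  finally show "inf c a \<le> b" .
next
  assume "inf c a \<le> b"
  then show "c \<le> heyting a b"
    unfolding heyting_def by (auto intro: Sup_upper)
qed

text \<open>The case \<open>B = {}\<close> of the first conjunct says that the top element belongs to \<open>S\<close>.\<close>

definition is_sublocale :: "'a::frame set \<Rightarrow> bool" where
  "is_sublocale S \<longleftrightarrow>
     (\<forall>B. B \<subseteq> S \<longrightarrow> Inf B \<in> S) \<and> (\<forall>a. \<forall>s\<in>S. heyting a s \<in> S)"

definition is_dense :: "'a::frame set \<Rightarrow> bool" where
  "is_dense S \<longleftrightarrow> bot \<in> S"

text \<open>
  The structure of the locale \<open>S\<close> with the induced order, for \<open>S\<close> a sublocale of the ambient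
  type. Meets in \<open>S\<close> are ambient meets; joins in \<open>S\<close> are in general larger than ambient joins,
  being the meet of the upper bounds that lie in \<open>S\<close>. The least element of \<open>S\<close> is the empty
  join in \<open>S\<close> and need not be the ambient \<^const>\<open>bot\<close>. For \<open>S = UNIV\<close> one recovers the ambient
  operations. Outside meet-closed sets these constants have no intended meaning.
\<close>

definition join_in :: "'a::frame set \<Rightarrow> 'a set \<Rightarrow> 'a" where
  "join_in S B = Inf {u \<in> S. \<forall>b\<in>B. b \<le> u}"

definition bot_in :: "'a::frame set \<Rightarrow> 'a" where
  "bot_in S = join_in S {}"

definition heyting_in :: "'a::frame set \<Rightarrow> 'a \<Rightarrow> 'a \<Rightarrow> 'a" where
  "heyting_in S a b = join_in S {c \<in> S. inf c a \<le> b}"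

definition pcompl_in :: "'a::frame set \<Rightarrow> 'a \<Rightarrow> 'a" where
  "pcompl_in S a = heyting_in S a (bot_in S)"

lemma join_in_closed: "is_sublocale S \<Longrightarrow> join_in S B \<in> S"
  unfolding is_sublocale_def join_in_def by auto

lemma join_in_upper: "b \<in> B \<Longrightarrow> b \<le> join_in S B"
  unfolding join_in_def by (auto intro: Inf_greatest)

lemma join_in_least: "u \<in> S \<Longrightarrow> (\<And>b. b \<in> B \<Longrightarrow> b \<le> u) \<Longrightarrow> join_in S B \<le> u"
  unfolding join_in_def by (auto intro: Inf_lower)

lemma bot_in_least: "u \<in> S \<Longrightarrow> bot_in S \<le> u"
  unfolding bot_in_def by (rule join_in_least) auto

lemma sublocale_inf_closed: "is_sublocale S \<Longrightarrow> a \<in> S \<Longrightarrow> b \<in> S \<Longrightarrow> inf a b \<in> S"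
  unfolding is_sublocale_def by (metis Inf_insert Inf_empty inf_top_right empty_subsetI insert_subset)

lemma heyting_in_eq_heyting:
  assumes "is_sublocale S" "b \<in> S"
  shows "heyting_in S a b = heyting a b"
proof (rule order.antisym)
  have "heyting a b \<in> S"
    using assms unfolding is_sublocale_def by blast
  then show "heyting_in S a b \<le> heyting a b"
    unfolding heyting_in_def by (rule join_in_least) (auto simp: heyting_adjoint)
  show "heyting a b \<le> heyting_in S a b"
    unfolding heyting_in_def
    by (rule join_in_upper) (use \<open>heyting a b \<in> S\<close> heyting_adjoint in auto)
qed

lemma sublocale_frame_law:
  assumes "is_sublocale S" "a \<in> S" "B \<subseteq> S"
  shows "inf a (join_in S B) = join_in S {inf a b | b. b \<in> B}" (is "?l = ?r")
proof (rule order.antisym)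
  have "?r \<in> S" using assms(1) by (rule join_in_closed)
  then have *: "heyting a ?r \<in> S" using assms(1) unfolding is_sublocale_def by blast
  have "b \<le> heyting a ?r" if "b \<in> B" for b
    unfolding heyting_adjoint by (rule join_in_upper) (use that inf.commute in blast)
  then have "join_in S B \<le> heyting a ?r" using * by (blast intro: join_in_least)
  then show "?l \<le> ?r" by (simp add: heyting_adjoint inf.commute)
  show "?r \<le> ?l"
    by (rule join_in_least)
      (use assms in \<open>auto intro: sublocale_inf_closed join_in_closed le_infI2 join_in_upper\<close>)
qed

lemma join_in_UNIV: "join_in UNIV B = Sup B"
  unfolding join_in_def by (rule order.antisym) (auto intro: Inf_lower Inf_greatest Sup_upper Sup_least)

text \<open>
  A family is represented by the set \<open>B\<close> of its members, since both joins depend only on that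
  set; this covers arbitrary index sets, the empty one included.
\<close>

definition IED :: "'a::frame set \<Rightarrow> bool" where
  "IED S \<longleftrightarrow>
     (\<forall>B. B \<subseteq> S \<longrightarrow>
        pcompl_in S (pcompl_in S (join_in S B))
          \<le> join_in S {pcompl_in S (pcompl_in S b) | b. b \<in> B})"

end

theory Submission
  imports Defs
begin

text \<open>
  Pseudocomplements in a dense sublocale \<open>T\<close> are the ambient ones, \<open>T\<close> contains every regular
  element \<open>x\<^sup>*\<close>, and a join in \<open>T\<close> has the same double pseudocomplement as the ambient join.
  Hence \<open>T\<close> is IED iff every \<open>u \<in> T\<close> lying above all \<open>b\<^sup>*\<^sup>*\<close>, \<open>b \<in> B\<close>, also lies above
  \<open>(\<Squnion>B)\<^sup>*\<^sup>*\<close>, for arbitrary sets \<open>B\<close> of ambient elements. This is a condition on single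
  elements, preserved by meets; requiring it of all \<open>a \<rightarrow> u\<close> makes it stable under the Heyting
  operation as well, and the elements satisfying it form the largest dense IED sublocale.
\<close>

abbreviation pcompl :: "'a::frame \<Rightarrow> 'a" where
  "pcompl a \<equiv> heyting a bot"

lemma pcompl_antimono: "a \<le> b \<Longrightarrow> pcompl b \<le> pcompl (a::'a::frame)"
  unfolding heyting_adjoint
  by (rule order.trans[OF inf_mono[OF order.refl]], assumption) (simp flip: heyting_adjoint)

lemma le_pcompl_pcompl: "(a::'a::frame) \<le> pcompl (pcompl a)"
  unfolding heyting_adjoint by (subst inf.commute) (simp flip: heyting_adjoint)

lemma pcompl3: "pcompl (pcompl (pcompl a)) = pcompl (a::'a::frame)"
  by (intro order.antisym pcompl_antimono le_pcompl_pcompl)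

lemma heyting_top_left: "heyting top u = (u::'a::frame)"
proof -
  have "x \<le> heyting top u \<longleftrightarrow> x \<le> u" for x
    by (simp add: heyting_adjoint)
  then show ?thesis by (metis order.eq_iff)
qed

lemma heyting_heyting: "heyting a (heyting b u) = heyting (inf a b) (u::'a::frame)"
proof -
  have "x \<le> heyting a (heyting b u) \<longleftrightarrow> x \<le> heyting (inf a b) u" for x
    by (simp add: heyting_adjoint inf.assoc)
  then show ?thesis by (metis order.eq_iff)
qed

text \<open>\<open>heyting a\<close> preserves meets. The form with a lower bound \<open>x\<close>
  suits \<open>absorbs_regular\<close>, where \<open>u\<close> occurs only as an upper
  bound.\<close>

lemma le_heyting_Inf: "x \<le> heyting a (Inf B) \<longleftrightarrow> (\<forall>u\<in>B. x \<le> heyting a (u::'a::frame))"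
  by (simp add: heyting_adjoint le_Inf_iff)

lemma pcompl_in_dense:
  assumes "is_sublocale S" "is_dense S"
  shows "pcompl_in S a = pcompl a"
proof -
  have "bot_in S = bot"
    using assms(2) bot_in_least bot_unique unfolding is_dense_def by blast
  then show ?thesis
    using assms heyting_in_eq_heyting unfolding is_dense_def pcompl_in_def by metis
qed

definition absorbs_regular :: "'a::frame \<Rightarrow> bool" where
  "absorbs_regular u \<longleftrightarrow>
     (\<forall>B. (\<forall>b\<in>B. pcompl (pcompl b) \<le> u) \<longrightarrow> pcompl (pcompl (Sup B)) \<le> u)"

text \<open>Double pseudocomplement is monotone and fixes \<open>pcompl a\<close>, so a bound on
  \<open>Sup B\<close> passes to its double pseudocomplement. This yields density of the largest
  sublocale.\<close>

lemma absorbs_regular_pcompl: "absorbs_regular (pcompl (a::'a::frame))"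
  unfolding absorbs_regular_def
proof (intro allI impI)
  fix B assume "\<forall>b\<in>B. pcompl (pcompl b) \<le> pcompl a"
  then have "Sup B \<le> pcompl a"
    by (intro Sup_least) (rule order.trans[OF le_pcompl_pcompl], simp)
  then show "pcompl (pcompl (Sup B)) \<le> pcompl a"
    by (metis pcompl3 pcompl_antimono)
qed

lemma IED_dense_iff:
  fixes S :: "'a::frame set"
  assumes S: "is_sublocale S" and d: "is_dense S"
  shows "IED S \<longleftrightarrow> (\<forall>u\<in>S. absorbs_regular u)"
proof -
  have reg: "pcompl x \<in> S" for x
    using S d unfolding is_sublocale_def is_dense_def by blast
  note pc = pcompl_in_dense[OF S d]
  show ?thesis
  proof
    assume IED: "IED S"
    show "\<forall>u\<in>S. absorbs_regular u"
      unfolding absorbs_regular_def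
    proof (intro ballI allI impI)
      fix u B assume u: "u \<in> S" and B: "\<forall>b\<in>B. pcompl (pcompl b) \<le> u"
      \<comment> \<open>\<open>B\<close> need not lie in \<open>S\<close>, so IED is applied to the
        regular elements \<open>C\<close>, whose join in \<open>S\<close> still bounds
        \<open>B\<close>.\<close>
      define C where "C = (\<lambda>b. pcompl (pcompl b)) ` B"
      have "C \<subseteq> S" using reg unfolding C_def by blast
      have "Sup B \<le> join_in S C"
      proof (rule Sup_least)
        fix b assume "b \<in> B"
        then have "pcompl (pcompl b) \<le> join_in S C"
          unfolding C_def by (intro join_in_upper imageI)
        then show "b \<le> join_in S C"
          by (rule order.trans[OF le_pcompl_pcompl])
      qed
      then have "pcompl (pcompl (Sup B)) \<le> pcompl (pcompl (join_in S C))"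
        by (intro pcompl_antimono)
      also have "\<dots> \<le> join_in S {pcompl (pcompl c) | c. c \<in> C}"
        using IED[unfolded IED_def pc, rule_format, OF \<open>C \<subseteq> S\<close>] .
      also have "\<dots> \<le> u"
        using u B by (intro join_in_least) (auto simp: C_def pcompl3)
      finally show "pcompl (pcompl (Sup B)) \<le> u" .
    qed
  next
    assume abs: "\<forall>u\<in>S. absorbs_regular u"
    show "IED S"
      unfolding IED_def pc
    proof (intro allI impI)
      fix B assume "B \<subseteq> S"
      \<comment> \<open>\<open>Sup B\<close> may lie outside \<open>S\<close>, but its double
        pseudocomplement is an upper bound of \<open>B\<close> inside \<open>S\<close>.\<close>
      have "join_in S B \<le> pcompl (pcompl (Sup B))"
        by (intro join_in_least[OF reg] order.trans[OF Sup_upper le_pcompl_pcompl])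
      then have "pcompl (pcompl (join_in S B)) \<le> pcompl (pcompl (Sup B))"
        by (metis pcompl3 pcompl_antimono)
      also have "\<dots> \<le> join_in S {pcompl (pcompl b) | b. b \<in> B}"
      proof -
        have "absorbs_regular (join_in S {pcompl (pcompl b) | b. b \<in> B})"
          using abs join_in_closed[OF S] by blast
        moreover have "\<forall>b\<in>B. pcompl (pcompl b) \<le> join_in S {pcompl (pcompl b) | b. b \<in> B}"
          by (blast intro: join_in_upper)
        ultimately show ?thesis unfolding absorbs_regular_def by simp
      qed
      finally show "pcompl (pcompl (join_in S B)) \<le> join_in S {pcompl (pcompl b) | b. b \<in> B}" .
    qed
  qed
qed

theorem proposition7p4:
  shows "\<exists>S :: 'a::frame set.
    is_sublocale S \<and> is_dense S \<and> IED S \<and>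
    (\<forall>T. is_sublocale T \<and> is_dense T \<and> IED T \<longrightarrow> T \<subseteq> S)"
proof -
  define S :: "'a set" where "S = {u. \<forall>a. absorbs_regular (heyting a u)}"
  have sub: "is_sublocale S"
    unfolding is_sublocale_def
  proof (intro conjI allI impI ballI)
    fix B assume "B \<subseteq> S"
    then show "Inf B \<in> S"
      unfolding S_def absorbs_regular_def by (simp add: le_heyting_Inf) blast
  next
    fix a s assume "s \<in> S"
    then show "heyting a s \<in> S"
      \<comment> \<open>Nested implications collapse to \<open>heyting (inf a b) s\<close>, which
        the quantifier in \<open>S\<close> already covers.\<close>
      unfolding S_def by (simp add: heyting_heyting)
  qed
  have dense: "is_dense S"
    unfolding is_dense_def S_def by (simp add: absorbs_regular_pcompl)
  \<comment> \<open>The instance \<open>a = top\<close> of the membership condition.\<close>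
  have "absorbs_regular u" if "u \<in> S" for u
    using that unfolding S_def by (metis heyting_top_left mem_Collect_eq)
  then have "IED S"
    using IED_dense_iff[OF sub dense] by blast
  moreover have "T \<subseteq> S" if T: "is_sublocale T" "is_dense T" "IED T" for T
  proof
    fix u assume "u \<in> T"
    then have "heyting a u \<in> T" for a
      using T(1) unfolding is_sublocale_def by simp
    then show "u \<in> S"
      unfolding S_def using IED_dense_iff[OF T(1,2)] T(3) by simp
  qed
  ultimately show ?thesis using sub dense by blast
qed

end
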